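(* Suppose $f$ is a pseudo-planar function over $\mathbb{F}_{2^n}$, identified with a function $f:T\to T$, and let $D_f=\{x+2\sqrt{f(x)}\mid x\in T\}\subseteq R=GR(4,n)$. Then the Fourier spectrum of $f$, i.e. the multiset $\{\chi(D_f)\mid\chi\in\widehat{R}\}$, is as follows. If $n$ is odd, put $b=2^{(n-1)/2}$. The values and their frequencies are: $2b^2$ with frequency $1$; $0$ with frequency $2b^2-1$; $b+b\mathbf{i}$ and $b-b\mathbf{i}$, each with frequency $\frac{b(2b^3+2b^2-b-1)}{2}$; $-b+b\mathbf{i}$ and $-b-b\mathbf{i}$, each with frequency $\frac{b(2b^3-2b^2-b+1)}{2}$. If $n$ is even, put $b=2^{(n-2)/2}$. The values and their frequencies are: $4b^2$ with frequency $1$; $0$ with frequency $4b^2-1$; $2b$ with frequency $b(4b^3+4b^2-b-1)$; $-2b$ with frequency $b(4b^3-4b^2-b+1)$; $2b\mathbf{i}$ and $-2b\mathbf{i}$, each with frequency $b^2(4b^2-1)$.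
   Context: $R=GR(4,n)$ is the Galois ring of characteristic $4$ with $4^n$ elements, and $Z=\{2x\mid x\in R\}$. The unit group $R\setminus Z$ contains a cyclic subgroup of order $2^n-1$ generated by some $\xi$; $T=\{\xi^i\mid 0\le i\le 2^n-2\}\cup\{0\}$ is the Teichmüller system. Each $x\in R$ is uniquely $x=a+2b$ with $a,b\in T$. Write $\sqrt{x}=x^{2^{n-1}}$. With $x\oplus y=x+y+2\sqrt{xy}$, $(T,\oplus,\cdot)$ is a field with $2^n$ elements, identified with $\mathbb{F}_{2^n}$. A function $f:T\to T$ is pseudo-planar if for each $\epsilon\in T\setminus\{0\}$ the map $x\mapsto f(x\oplus\epsilon)\oplus f(x)\oplus\epsilon x$ is a permutation of $T$. Trace: $\mathrm{Tr}:R\to\mathbb{Z}_4$, $\mathrm{Tr}(x)=\sum_{i=0}^{n-1}\sigma^i(x)$, where $\sigma(a+2b)=a^2+2b^2$ for $a,b\in T$. With $\mathbf{i}=\sqrt{-1}$, the characters of $(R,+)$ are $\chi_a(x)=\mathbf{i}^{\mathrm{Tr}(ax)}$, $a\in R$, and $\widehat{R}=\{\chi_a\mid a\in R\}$. For $A\subseteq R$, $\chi(A)=\sum_{g\in A}\chi(g)$.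
   Formalization: The formal theorem adds the hypothesis f(0) = 0; without it the claim is false (n = 1, f constantly 1 gives the values 2, 0, -1-i, -1+i), and the stated frequencies force f(0) = 0. *)

theory Defs
  imports Complex_Main "HOL-Library.Multiset" "HOL-Library.FuncSet" "HOL-Library.Cardinality"
    "HOL-Computational_Algebra.Computational_Algebra"
begin

text \<open>
  A Galois ring is a finite commutative ring with identity whose zero divisors, together with 0,
  form the principal ideal generated by a prime number. Since \<open>1 \<noteq> 0\<close> in the class
  \<open>comm_ring_1\<close>, the set of zero divisors below contains 0.
\<close>
definition galois_ring :: "'a::{finite,comm_ring_1} itself \<Rightarrow> bool" where
  "galois_ring _ \<longleftrightarrow>
     (\<exists>p::nat. prime p \<and> {x::'a. \<exists>y. y \<noteq> 0 \<and> x * y = 0} = {of_nat p * r | r. True})"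

definition galois_ring_4 :: "'a::{finite,comm_ring_1} itself \<Rightarrow> nat \<Rightarrow> bool" where
  "galois_ring_4 R n \<longleftrightarrow> galois_ring R \<and> CHAR('a) = 4 \<and> CARD('a) = 4 ^ n"

definition teichmuller_generator :: "nat \<Rightarrow> 'a::comm_ring_1 \<Rightarrow> bool" where
  "teichmuller_generator n \<xi> \<longleftrightarrow> \<xi> dvd 1 \<and> card (range (\<lambda>i::nat. \<xi> ^ i)) = 2 ^ n - 1"

definition teichmuller :: "nat \<Rightarrow> 'a::comm_ring_1 \<Rightarrow> 'a set" where
  "teichmuller n \<xi> = {\<xi> ^ i | i. i \<le> 2 ^ n - 2} \<union> {0}"

definition gsqrt :: "nat \<Rightarrow> 'a::comm_ring_1 \<Rightarrow> 'a" where
  "gsqrt n x = x ^ (2 ^ (n - 1))"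

text \<open>The addition of the field structure on the Teichmueller system.\<close>
definition tadd :: "nat \<Rightarrow> 'a::comm_ring_1 \<Rightarrow> 'a \<Rightarrow> 'a" where
  "tadd n x y = x + y + 2 * gsqrt n (x * y)"

text \<open>Only the values of \<open>f\<close> on the Teichmueller system \<open>T\<close> matter.\<close>
definition pseudo_planar :: "nat \<Rightarrow> 'a::comm_ring_1 \<Rightarrow> ('a \<Rightarrow> 'a) \<Rightarrow> bool" where
  "pseudo_planar n \<xi> f \<longleftrightarrow>
     (let T = teichmuller n \<xi> in
      f \<in> T \<rightarrow> T \<and>
      (\<forall>\<epsilon>\<in>T - {0}.
        bij_betw (\<lambda>x. tadd n (tadd n (f (tadd n x \<epsilon>)) (f x)) (\<epsilon> * x)) T T))"

definition frobenius :: "nat \<Rightarrow> 'a::comm_ring_1 \<Rightarrow> 'a \<Rightarrow> 'a" where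
  "frobenius n \<xi> x =
     (THE y. \<exists>a\<in>teichmuller n \<xi>. \<exists>b\<in>teichmuller n \<xi>. x = a + 2 * b \<and> y = a ^ 2 + 2 * b ^ 2)"

definition gtrace :: "nat \<Rightarrow> 'a::comm_ring_1 \<Rightarrow> 'a \<Rightarrow> 'a" where
  "gtrace n \<xi> x = (\<Sum>i<n. (frobenius n \<xi> ^^ i) x)"

text \<open>
  The trace takes values in the prime subring, which is a copy of the integers modulo 4;
  the representative in \<open>{0, 1, 2, 3}\<close> is the exponent of the imaginary unit.
\<close>
definition add_char :: "nat \<Rightarrow> 'a::comm_ring_1 \<Rightarrow> 'a \<Rightarrow> 'a \<Rightarrow> complex" where
  "add_char n \<xi> a x = \<i> ^ (THE k::nat. k < 4 \<and> of_nat k = gtrace n \<xi> (a * x))"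

definition add_chars :: "nat \<Rightarrow> 'a::comm_ring_1 \<Rightarrow> ('a \<Rightarrow> complex) set" where
  "add_chars n \<xi> = {add_char n \<xi> a | a. True}"

definition D_set :: "nat \<Rightarrow> 'a::comm_ring_1 \<Rightarrow> ('a \<Rightarrow> 'a) \<Rightarrow> 'a set" where
  "D_set n \<xi> f = {x + 2 * gsqrt n (f x) | x. x \<in> teichmuller n \<xi>}"

text \<open>One entry for each character, so equal character sums are counted with multiplicity.\<close>
definition fourier_spectrum :: "nat \<Rightarrow> 'a::{finite,comm_ring_1} \<Rightarrow> 'a set \<Rightarrow> complex multiset" where
  "fourier_spectrum n \<xi> A = image_mset (\<lambda>\<chi>. \<Sum>g\<in>A. \<chi> g) (mset_set (add_chars n \<xi>))"

end

theory Submission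
  imports Defs "HOL-Number_Theory.Cong"
begin

text \<open>
  Write \<open>d x = x + 2 \<surd>(f x)\<close> and expand \<open>|\<chi>(D)|\<^sup>2\<close> over pairs \<open>(x, y) \<in> T \<times> T\<close>, grouped by
  the difference \<open>\<epsilon>\<close> of their residue classes. For \<open>\<epsilon> \<noteq> 0\<close> pseudo-planarity turns the inner sum
  into a multiple of \<open>\<chi>(2R)\<close>, so \<open>|\<chi>(D)|\<^sup>2 = 2^n\<close> whenever \<open>\<chi>\<close> is nontrivial on \<open>2R\<close>; since
  \<open>\<chi>(D)\<close> is a Gaussian integer, only four values remain. A nontrivial \<open>\<chi>\<close> that is trivial on
  \<open>2R\<close> has \<open>\<chi>(D) = 0\<close>. As \<open>f 0 = 0\<close>, both \<open>d x = 0\<close> and \<open>d x + d y = 0\<close> have only the zero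
  solution, so the sums of \<open>\<chi>(D)\<close> and of \<open>\<chi>(D)\<^sup>2\<close> over all characters equal \<open>4^n\<close>; together
  with the number of characters this determines the four frequencies.

  On the ring side, \<open>x \<equiv> y\<close> modulo \<open>2R\<close> implies \<open>x\<^sup>2 = y\<^sup>2\<close>, so \<open>x^(2^n)\<close> is the element of \<open>T\<close>
  congruent to \<open>x\<close>, and the addition of \<open>T\<close> is \<open>(x + y)^(2^n)\<close>.
\<close>

section \<open>Zero divisors, units and residue classes modulo \<open>2R\<close>\<close>

locale galois_ring_char_4 =
  fixes n :: nat and \<xi> :: "'a::{finite,comm_ring_1}"
  assumes galois_ring_4: "galois_ring_4 TYPE('a) n"
    and generator: "teichmuller_generator n \<xi>"
begin

abbreviation T :: "'a set" where "T \<equiv> teichmuller n \<xi>"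

lemma CHAR_eq: "CHAR('a) = 4" and card_eq: "CARD('a) = 4 ^ n"
  using galois_ring_4 by (auto simp: galois_ring_4_def)

lemma four_eq_0 [simp]: "(4::'a) = 0"
  using of_nat_CHAR[where 'a='a] by (simp add: CHAR_eq)

lemma two_neq_0: "(2::'a) \<noteq> 0"
  using of_nat_eq_0_iff_char_dvd[where 'a='a, of 2] by (simp add: CHAR_eq)

lemma n_pos: "n > 0"
proof (rule ccontr)
  assume "\<not> n > 0"
  then have "CARD('a) = 1" using card_eq by simp
  then obtain c where "(UNIV::'a set) = {c}" by (auto simp: card_1_singleton_iff)
  then have "(1::'a) = 0" by (metis UNIV_I singletonD)
  then show False by simp
qed

lemma two_two_mult [simp]: "2 * (2 * x) = (0::'a)"
  using four_eq_0 by (simp flip: mult.assoc)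

text \<open>The prime \<open>p\<close> in the definition of a Galois ring is left open, but it must
  be 2: \<open>p\<close> itself is a zero divisor, whereas an odd \<open>p\<close> satisfies
  \<open>p * p = 1\<close> in characteristic 4.\<close>

lemma zero_divisors: "(\<exists>y. y \<noteq> 0 \<and> x * y = 0) \<longleftrightarrow> 2 dvd x" for x :: 'a
proof -
  obtain p :: nat where p: "prime p"
    and Z: "{x::'a. \<exists>y. y \<noteq> 0 \<and> x * y = 0} = {of_nat p * r | r. True}"
    using galois_ring_4 by (auto simp: galois_ring_4_def galois_ring_def)
  have "of_nat p * (1::'a) \<in> {x::'a. \<exists>y. y \<noteq> 0 \<and> x * y = 0}" unfolding Z by blast
  then obtain y :: 'a where y: "y \<noteq> 0" "of_nat p * y = 0" by auto
  have "p = 2"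
  proof (rule ccontr)
    assume "p \<noteq> 2"
    then have "odd p" using p by (metis primes_dvd_imp_eq two_is_prime_nat)
    then obtain k where k: "p = 2 * k + 1" by (rule oddE)
    have "of_nat p * of_nat p = 1 + 4 * ((of_nat k)\<^sup>2 + of_nat k :: 'a)"
      by (simp add: k algebra_simps power2_eq_square)
    then have "of_nat p * of_nat p = (1::'a)" by (simp add: four_eq_0)
    then have "y = 0" using y(2) by (metis mult.assoc mult_1 mult_zero_right)
    with y(1) show False by simp
  qed
  then show ?thesis using Z by (auto simp: dvd_def set_eq_iff)
qed

text \<open>Congruence modulo \<open>2R\<close> is expressed throughout as \<open>2 * x = 2 * y\<close>.\<close>
lemma two_mult_eq_0_iff: "2 * x = 0 \<longleftrightarrow> 2 dvd x" for x :: 'a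
proof
  assume "2 * x = 0"
  then have "x * 2 = 0" by (simp add: mult.commute)
  then show "2 dvd x" using zero_divisors[of x] two_neq_0 by blast
next
  assume "2 dvd x"
  then obtain y where "x = 2 * y" by (rule dvdE)
  then show "2 * x = 0" by (simp only: two_two_mult)
qed

lemma two_mult_uminus: "2 * (- x) = (2 * x :: 'a)"
  using two_two_mult[of x] by (metis add_eq_0_iff mult_2 mult_minus_right)

lemma two_mult_eqE:
  assumes "2 * x = (2 * y :: 'a)"
  obtains z where "x = y + 2 * z"
proof -
  have "2 dvd x - y" using assms by (simp add: algebra_simps flip: two_mult_eq_0_iff)
  then show ?thesis using that by (metis add.commute diff_add_cancel dvdE)
qed

text \<open>With \<open>x = y + 2 * z\<close>, the cross term and the square of \<open>2 * z\<close>
  are both multiples of 4. So squaring lifts a congruence modulo \<open>2R\<close> to an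
  equality.\<close>

lemma square_cong:
  assumes "2 * x = (2 * y :: 'a)"
  shows "x\<^sup>2 = y\<^sup>2"
proof -
  obtain z where "x = y + 2 * z" using two_mult_eqE[OF assms] .
  then have "x\<^sup>2 = y\<^sup>2 + 4 * (y * z + z\<^sup>2)" by (simp add: algebra_simps power2_eq_square)
  then show ?thesis by (simp add: four_eq_0)
qed

lemma two_mult_power_cong:
  assumes "2 * x = (2 * y :: 'a)"
  shows "2 * x ^ k = 2 * y ^ k"
proof (induction k)
  case (Suc k)
  have "2 * x ^ Suc k = x * (2 * x ^ k)" by (simp add: ac_simps)
  also have "\<dots> = (2 * x) * y ^ k" by (simp only: Suc mult.left_commute mult.assoc)
  also have "\<dots> = 2 * y ^ Suc k" by (simp only: assms) (simp add: ac_simps)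
  finally show ?case .
qed simp

lemma power_2_power_cong:
  assumes "2 * x = (2 * y :: 'a)" "k > 0"
  shows "x ^ (2 ^ k) = y ^ (2 ^ k)"
proof -
  obtain j where "k = Suc j" using assms(2) gr0_implies_Suc by blast
  then show ?thesis using square_cong[OF assms(1)] by (simp add: power_mult)
qed

text \<open>An element outside \<open>2R\<close> is no zero divisor, so multiplication by it is
  injective and, the ring being finite, surjective.\<close>

lemma is_unit_if_two_mult_neq_0:
  assumes "2 * x \<noteq> (0::'a)"
  shows "x dvd 1"
proof -
  have "inj ((*) x)"
  proof (rule injI)
    fix y z assume "x * y = x * z"
    then have "x * (y - z) = 0" by (simp add: algebra_simps)
    moreover have "\<not> (\<exists>y. y \<noteq> 0 \<and> x * y = 0)"
      using zero_divisors assms two_mult_eq_0_iff by blast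
    ultimately have "y - z = 0" by blast
    then show "y = z" by simp
  qed
  then have "surj ((*) x)" by (simp add: finite_UNIV_inj_surj)
  then show ?thesis by (metis dvdI surjD)
qed

text \<open>Doubling has \<open>2R\<close> both as kernel and as image, and its nonempty fibres all
  have the size of the kernel, so \<open>4 ^ n\<close> is the square of this cardinality.\<close>

lemma card_two_multiples: "card (range ((*) (2::'a))) = 2 ^ n"
proof -
  let ?Z = "{x::'a. 2 * x = 0}"
  have Z: "range ((*) (2::'a)) = ?Z" by (auto simp: two_mult_eq_0_iff)
  have fibre: "card {x::'a. 2 * x = z} = card ?Z" if "z \<in> range ((*) 2)" for z
  proof -
    from that obtain c where c: "z = 2 * c" by blast
    have "bij_betw (\<lambda>x. x - c) {x::'a. 2 * x = z} ?Z"
      by (rule bij_betw_byWitness[where f' = "\<lambda>x. x + c"]) (auto simp: c algebra_simps)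
    then show ?thesis by (rule bij_betw_same_card)
  qed
  have "CARD('a) = (\<Sum>z\<in>range ((*) 2). card {x\<in>(UNIV::'a set). 2 * x = z})"
    using sum.image_gen[of "UNIV :: 'a set" "\<lambda>_. 1::nat" "(*) 2"] by simp
  also have "\<dots> = (\<Sum>z\<in>range ((*) (2::'a)). card ?Z)"
    by (rule sum.cong[OF refl]) (simp only: UNIV_I simp_thms fibre)
  also have "\<dots> = card ?Z * card ?Z" unfolding Z by simp
  finally have "(card ?Z)\<^sup>2 = (2 ^ n)\<^sup>2"
    using power_mult_distrib[of "2::nat" 2 n] by (simp add: card_eq power2_eq_square)
  then show ?thesis unfolding Z by (rule power_eq_imp_eq_base) auto
qed

section \<open>The powers of \<open>\<xi>\<close> and the Teichmueller system\<close>

lemma generator_unit: "\<xi> dvd 1" and card_powers: "card (range (\<lambda>i::nat. \<xi> ^ i)) = 2 ^ n - 1"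
  using generator by (auto simp: teichmuller_generator_def)

text \<open>Multiplication by \<open>\<xi>\<close> permutes the set of its powers, so the product
  over that set does not change when multiplied by \<open>\<xi> ^ (2 ^ n - 1)\<close>. This product
  is a unit and cancels.\<close>

lemma generator_power: "\<xi> ^ (2 ^ n - 1) = 1"
proof -
  let ?P = "range (\<lambda>i::nat. \<xi> ^ i)"
  have unit: "x dvd 1" if "x \<in> ?P" for x
  proof -
    from that obtain i where "x = \<xi> ^ i" by blast
    then show ?thesis using dvd_power_same[OF generator_unit, of i] by simp
  qed
  obtain v where v: "1 = \<xi> * v" using generator_unit by (rule dvdE)
  have inj: "inj_on ((*) \<xi>) ?P"
  proof (rule inj_onI)
    fix x y assume "\<xi> * x = \<xi> * y"
    then have "v * (\<xi> * x) = v * (\<xi> * y)" by (rule arg_cong)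
    then have "(\<xi> * v) * x = (\<xi> * v) * y" by (simp only: ac_simps)
    then show "x = y" by (simp flip: v)
  qed
  have "(*) \<xi> ` ?P \<subseteq> ?P" by (auto intro: range_eqI[where x = "Suc _"])
  then have "(*) \<xi> ` ?P = ?P" by (intro endo_inj_surj inj) auto
  then have "prod id ?P = prod ((*) \<xi>) ?P"
    using prod.reindex[OF inj, of id] by simp
  also have "\<dots> = \<xi> ^ (2 ^ n - 1) * prod id ?P"
    by (simp add: prod.distrib card_powers)
  finally have *: "prod id ?P = \<xi> ^ (2 ^ n - 1) * prod id ?P" .
  have "prod id ?P dvd prod (\<lambda>_. 1) ?P" by (rule prod_dvd_prod) (simp only: id_apply unit)
  then have "prod id ?P dvd 1" by simp
  then obtain q where q: "1 = prod id ?P * q" by (rule dvdE)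
  have "\<xi> ^ (2 ^ n - 1) = \<xi> ^ (2 ^ n - 1) * (prod id ?P * q)" by (simp only: q[symmetric] mult_1_right)
  also have "\<dots> = 1" by (simp only: mult.assoc[symmetric] *[symmetric]) (simp only: q)
  finally show ?thesis .
qed

lemma N_pos: "(2::nat) ^ n - 1 > 0"
  using one_less_power[of "2::nat" n] n_pos by simp

lemma powers_less: "(\<lambda>i::nat. \<xi> ^ i) ` {..<2 ^ n - 1} = range (\<lambda>i::nat. \<xi> ^ i)"
proof -
  have "\<xi> ^ i = \<xi> ^ (i mod (2 ^ n - 1))" for i
    using power_add[of \<xi> "(2 ^ n - 1) * (i div (2 ^ n - 1))" "i mod (2 ^ n - 1)"]
    by (simp only: power_mult generator_power power_one mult_1 mult_div_mod_eq)
  moreover have "i mod (2 ^ n - 1) < 2 ^ n - 1" for i :: nat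
    by (rule mod_less_divisor[OF N_pos])
  ultimately show ?thesis by blast
qed

lemma inj_on_powers: "inj_on (\<lambda>i::nat. \<xi> ^ i) {..<2 ^ n - 1}"
  by (rule eq_card_imp_inj_on) (simp_all only: powers_less card_powers finite_lessThan card_lessThan)

lemma T_eq: "T = insert 0 (range (\<lambda>i::nat. \<xi> ^ i))"
proof -
  \<comment> \<open>If \<open>2 ^ n\<close> were 1, truncated subtraction would make the first set
    below \<open>{0}\<close> and the second one empty.\<close>
  have "(2::nat) ^ n \<ge> 2" using n_pos by (simp add: self_le_power)
  then have "{i::nat. i \<le> 2 ^ n - 2} = {..<2 ^ n - 1}" by auto
  then show ?thesis by (auto simp: teichmuller_def simp flip: powers_less)
qed

lemma T_power: "x \<in> T \<Longrightarrow> x ^ (2 ^ n) = x"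
proof -
  assume "x \<in> T"
  then consider "x = 0" | i where "x = \<xi> ^ i" by (auto simp: T_eq)
  then show ?thesis
  proof cases
    case 1
    then show ?thesis by (simp add: zero_power)
  next
    case 2
    have "x ^ (2 ^ n) = x ^ (2 ^ n - 1) * x"
      by (metis power_minus_mult zero_less_numeral zero_less_power)
    moreover have "x ^ (2 ^ n - 1) = 1"
      by (metis 2 generator_power mult.commute power_mult power_one)
    ultimately show ?thesis by simp
  qed
qed

text \<open>The \<open>2 ^ n\<close>-th power fixes every element of \<open>T\<close> and depends
  only on the residue class modulo \<open>2R\<close>.\<close>

lemma T_cong_imp_eq: "x \<in> T \<Longrightarrow> y \<in> T \<Longrightarrow> 2 * x = 2 * y \<Longrightarrow> x = y"
  using power_2_power_cong[of x y n] n_pos by (simp add: T_power)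

lemma zero_in_T [simp]: "0 \<in> T" and one_in_T [simp]: "1 \<in> T"
  using rangeI[of "\<lambda>i. \<xi> ^ i" 0] by (simp_all add: T_eq)

lemma card_T: "card T = 2 ^ n"
proof -
  have "0 \<notin> range (\<lambda>i::nat. \<xi> ^ i)"
  proof
    assume "0 \<in> range (\<lambda>i::nat. \<xi> ^ i)"
    then obtain i :: nat where "0 = \<xi> ^ i" by (rule rangeE)
    then show False using dvd_power_same[OF generator_unit, of i] by simp
  qed
  then show ?thesis by (simp add: T_eq card_powers)
qed

text \<open>Doubling is injective on \<open>T\<close>, and \<open>T\<close> has as many elements as
  \<open>2R\<close>. Hence \<open>T\<close> meets every residue class modulo
  \<open>2R\<close>.\<close>

lemma two_mult_image_T: "(*) 2 ` T = range ((*) (2::'a))"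
proof (rule card_subset_eq)
  show "card ((*) 2 ` T) = card (range ((*) (2::'a)))"
    using card_image[of "(*) 2" T] T_cong_imp_eq
    by (simp add: card_T card_two_multiples inj_on_def)
qed auto

text \<open>The element of \<open>T\<close> in the residue class of \<open>x\<close> modulo \<open>2R\<close>.\<close>
definition teich :: "'a \<Rightarrow> 'a" where "teich x = x ^ (2 ^ n)"

lemma teich_T [simp]: "teich x \<in> T"
  and two_mult_teich [simp]: "2 * teich x = 2 * x"
proof -
  have "2 * x \<in> (*) 2 ` T" unfolding two_mult_image_T by simp
  then obtain a where a: "a \<in> T" "2 * x = 2 * a" by auto
  then have "teich x = a"
    using power_2_power_cong[of x a n] n_pos by (simp add: T_power teich_def)
  then show "teich x \<in> T" "2 * teich x = 2 * x" using a by auto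
qed

lemma teich_eq: "x \<in> T \<Longrightarrow> teich x = x"
  by (simp add: teich_def T_power)

lemma teich_cong: "2 * x = 2 * y \<Longrightarrow> teich x = teich y"
  by (rule T_cong_imp_eq) auto

lemma teich_square: "(teich x)\<^sup>2 = x\<^sup>2"
  by (rule square_cong) simp

text \<open>As the fixed points of a power map, \<open>T\<close> is visibly closed under products
  and powers.\<close>

lemma T_iff: "x \<in> T \<longleftrightarrow> x ^ (2 ^ n) = x"
  using teich_T[of x] by (auto simp: teich_def T_power)

lemma T_mult: "x \<in> T \<Longrightarrow> y \<in> T \<Longrightarrow> x * y \<in> T"
  by (simp add: T_iff power_mult_distrib)

lemma T_power_closed: "x \<in> T \<Longrightarrow> x ^ k \<in> T"
  by (simp add: T_iff flip: power_mult) (metis mult.commute power_mult)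

lemma decomposition:
  obtains a b where "a \<in> T" "b \<in> T" "x = a + 2 * b"
proof -
  obtain z where "x = teich x + 2 * z" using two_mult_eqE[of x "teich x"] by auto
  then have "x = teich x + 2 * teich z" by simp
  then show ?thesis using that teich_T by blast
qed

lemma decomposition_unique:
  assumes "a \<in> T" "b \<in> T" "c \<in> T" "d \<in> T" "a + 2 * b = c + 2 * d"
  shows "a = c \<and> b = d"
proof -
  have "2 * a = 2 * c"
    using arg_cong[OF assms(5), of "(*) 2"] by (simp add: distrib_left)
  then have "a = c" using T_cong_imp_eq assms by blast
  then show ?thesis using T_cong_imp_eq assms by auto
qed

section \<open>The addition and the square root of \<open>T\<close>\<close>

lemma power_2_power_add:
  "(x + y) ^ (2 ^ Suc k) = x ^ (2 ^ Suc k) + y ^ (2 ^ Suc k) + 2 * ((x * y) ^ (2 ^ k) :: 'a)"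
proof (induction k)
  case 0
  show ?case by (simp add: power2_eq_square algebra_simps)
next
  case (Suc k)
  let ?u = "x ^ (2 ^ Suc k)" and ?v = "y ^ (2 ^ Suc k)" and ?w = "(x * y) ^ (2 ^ k)"
  have sq: "z ^ (2 ^ Suc (Suc k)) = (z ^ (2 ^ Suc k))\<^sup>2" for z :: 'a
    by (metis mult.commute power_Suc power_mult)
  have "(x + y) ^ (2 ^ Suc (Suc k)) = (?u + ?v + 2 * ?w)\<^sup>2" by (simp only: sq Suc)
  \<comment> \<open>Squaring absorbs the even correction term of the previous stage, so only the new
    cross term \<open>2 * ?u * ?v\<close> remains.\<close>
  also have "\<dots> = (?u + ?v)\<^sup>2"
    by (rule square_cong) (simp add: distrib_left)
  also have "\<dots> = ?u\<^sup>2 + ?v\<^sup>2 + 2 * (x * y) ^ (2 ^ Suc k)"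
    by (simp add: power2_sum power_mult_distrib)
  finally show ?case by (simp only: sq)
qed

text \<open>At \<open>k = n - 1\<close> the correction term of the power formula is exactly
  \<open>2 * gsqrt n (x * y)\<close>. Hence \<open>tadd\<close> is the representative in
  \<open>T\<close> of the ordinary sum, and its laws reduce to congruences modulo
  \<open>2R\<close>.\<close>

lemma teich_add: "teich (x + y) = teich x + teich y + 2 * gsqrt n (x * y)"
proof -
  have "n = Suc (n - 1)" using n_pos by simp
  then show ?thesis using power_2_power_add[of x y "n - 1"] by (simp add: teich_def gsqrt_def)
qed

lemma tadd_eq: "x \<in> T \<Longrightarrow> y \<in> T \<Longrightarrow> tadd n x y = teich (x + y)"
  by (simp add: tadd_def teich_add teich_eq)

lemma gsqrt_T: "x \<in> T \<Longrightarrow> gsqrt n x \<in> T"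
  by (simp add: gsqrt_def T_power_closed)

lemma gsqrt_square: "(gsqrt n x)\<^sup>2 = teich x" and gsqrt_of_square: "gsqrt n (x\<^sup>2) = teich x"
proof -
  have "2 ^ (n - 1) * 2 = (2 ^ n :: nat)" using n_pos by (rule power_minus_mult)
  then show "(gsqrt n x)\<^sup>2 = teich x" "gsqrt n (x\<^sup>2) = teich x"
    by (simp_all only: gsqrt_def teich_def mult.commute[of 2] flip: power_mult)
qed

lemma bij_gsqrt: "bij_betw (gsqrt n) T T"
  by (rule bij_betw_byWitness[where f' = "\<lambda>x. x\<^sup>2"])
    (auto simp: gsqrt_T gsqrt_square gsqrt_of_square teich_eq T_power_closed)

lemma two_mult_gsqrt_teich: "2 * gsqrt n (teich x) = 2 * gsqrt n x"
  unfolding gsqrt_def by (rule two_mult_power_cong) simp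

text \<open>The square root is a power with exponent \<open>2 ^ (n - 1)\<close>; such powers are
  additive up to a multiple of 2, which the extra factor 2 removes.\<close>

lemma two_mult_gsqrt_add: "2 * gsqrt n (x + y) = 2 * gsqrt n x + 2 * (gsqrt n y :: 'a)"
proof (cases "n - 1")
  case 0
  then show ?thesis by (simp add: gsqrt_def distrib_left)
next
  case (Suc k)
  then show ?thesis by (simp only: gsqrt_def power_2_power_add) (simp add: distrib_left)
qed

section \<open>The Frobenius map and the trace\<close>

lemma frobenius_eq:
  assumes "a \<in> T" "b \<in> T"
  shows "frobenius n \<xi> (a + 2 * b) = a\<^sup>2 + 2 * b\<^sup>2"
  unfolding frobenius_def
proof (rule the_equality)
  show "\<exists>a'\<in>T. \<exists>b'\<in>T. a + 2 * b = a' + 2 * b' \<and> a\<^sup>2 + 2 * b\<^sup>2 = a'\<^sup>2 + 2 * b'\<^sup>2"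
    using assms by blast
qed (use assms decomposition_unique in blast)

lemma frobenius_add: "frobenius n \<xi> (x + y) = frobenius n \<xi> x + frobenius n \<xi> y"
proof -
  obtain a b where x: "a \<in> T" "b \<in> T" "x = a + 2 * b" using decomposition .
  obtain c d where y: "c \<in> T" "d \<in> T" "y = c + 2 * d" using decomposition .
  let ?s = "gsqrt n (a * c)"
  have s: "?s\<^sup>2 = a * c" by (simp add: gsqrt_square teich_eq T_mult x y)
  \<comment> \<open>Replacing \<open>a + c\<close> by its representative adds \<open>2 * ?s\<close>,
    which is taken back in the second component.\<close>
  have "x + y = teich (a + c) + 2 * teich (b + d - ?s)"
    by (simp add: teich_add teich_eq x y algebra_simps)
  then have "frobenius n \<xi> (x + y) = (a + c)\<^sup>2 + 2 * (b + d - ?s)\<^sup>2"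
    by (simp only: frobenius_eq teich_T teich_square)
  also have "\<dots> = a\<^sup>2 + 2 * b\<^sup>2 + (c\<^sup>2 + 2 * d\<^sup>2) + 2 * (a * c) + 2 * ?s\<^sup>2 + 4 * (b * d - b * ?s - d * ?s)"
    by (simp add: algebra_simps power2_eq_square)
  \<comment> \<open>The two leftover terms cancel because \<open>?s\<close> is a square root of
    \<open>a * c\<close> and 4 is 0.\<close>
  also have "2 * (a * c) + 2 * ?s\<^sup>2 = 4 * (a * c)" by (simp add: s)
  then have "a\<^sup>2 + 2 * b\<^sup>2 + (c\<^sup>2 + 2 * d\<^sup>2) + 2 * (a * c) + 2 * ?s\<^sup>2 + 4 * (b * d - b * ?s - d * ?s)
      = a\<^sup>2 + 2 * b\<^sup>2 + (c\<^sup>2 + 2 * d\<^sup>2)"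
    by (simp add: four_eq_0 add.assoc)
  finally show ?thesis by (simp add: x y frobenius_eq)
qed

lemma frobenius_0: "frobenius n \<xi> 0 = 0"
  using frobenius_add[of 0 0] by simp

lemma frobenius_sum: "frobenius n \<xi> (sum g A) = (\<Sum>i\<in>A. frobenius n \<xi> (g i))"
  by (induction A rule: infinite_finite_induct) (auto simp: frobenius_0 frobenius_add)

lemma frobenius_iter:
  assumes "a \<in> T" "b \<in> T"
  shows "(frobenius n \<xi> ^^ i) (a + 2 * b) = a ^ (2 ^ i) + 2 * b ^ (2 ^ i)"
proof (induction i)
  case (Suc i)
  then show ?case
    using frobenius_eq[of "a ^ (2 ^ i)" "b ^ (2 ^ i)"] assms
    by (simp add: T_power_closed mult.commute flip: power_mult)
qed simp

lemma frobenius_iter_add: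
  "(frobenius n \<xi> ^^ i) (x + y) = (frobenius n \<xi> ^^ i) x + (frobenius n \<xi> ^^ i) y"
  by (induction i) (auto simp: frobenius_add)

lemma gtrace_add: "gtrace n \<xi> (x + y) = gtrace n \<xi> x + gtrace n \<xi> y"
  by (simp add: gtrace_def frobenius_iter_add sum.distrib)

text \<open>The Frobenius map shifts the summands of the trace cyclically, since its
  \<open>n\<close>-th iterate is the identity.\<close>

lemma frobenius_gtrace: "frobenius n \<xi> (gtrace n \<xi> x) = gtrace n \<xi> x"
proof -
  let ?F = "\<lambda>i. (frobenius n \<xi> ^^ i) x"
  obtain a b where x: "a \<in> T" "b \<in> T" "x = a + 2 * b" using decomposition .
  have "frobenius n \<xi> (gtrace n \<xi> x) + ?F 0 = (\<Sum>i<Suc n. ?F i)"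
    by (simp add: gtrace_def frobenius_sum sum.lessThan_Suc_shift del: sum.lessThan_Suc)
  also have "\<dots> = gtrace n \<xi> x + ?F n" by (simp add: gtrace_def)
  also have "?F n = ?F 0" by (simp add: frobenius_iter x T_power)
  finally show ?thesis by simp
qed

lemma T_idempotent: "a \<in> T \<Longrightarrow> a\<^sup>2 = a \<Longrightarrow> a = 0 \<or> a = 1"
proof -
  assume a: "a \<in> T" "a\<^sup>2 = a"
  show ?thesis
  proof (cases "2 * a = 0")
    case True
    then show ?thesis using T_cong_imp_eq[of a 0] a by auto
  next
    case False
    then have "a dvd 1" by (rule is_unit_if_two_mult_neq_0)
    then obtain u where "1 = a * u" by (rule dvdE)
    then show ?thesis using a(2) by (metis mult.assoc mult_1_right power2_eq_square)
  qed
qed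

text \<open>By uniqueness of the decomposition, a fixed point \<open>a + 2 * b\<close> of the
  Frobenius map has idempotent components, and the only idempotents in \<open>T\<close> are 0 and
  1.\<close>

lemma gtrace_of_nat: "\<exists>k<4. gtrace n \<xi> x = of_nat k"
proof -
  obtain a b where t: "a \<in> T" "b \<in> T" "gtrace n \<xi> x = a + 2 * b" using decomposition .
  have "a\<^sup>2 + 2 * b\<^sup>2 = a + 2 * b" using frobenius_gtrace[of x] t by (simp add: frobenius_eq)
  then have "a\<^sup>2 = a \<and> b\<^sup>2 = b" by (intro decomposition_unique) (auto simp: t T_power_closed)
  then have "(a = 0 \<or> a = 1) \<and> (b = 0 \<or> b = 1)" using T_idempotent t by blast
  then have "gtrace n \<xi> x = of_nat 0 \<or> gtrace n \<xi> x = of_nat 1 \<or>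
      gtrace n \<xi> x = of_nat 2 \<or> gtrace n \<xi> x = of_nat 3"
    unfolding t(3) by auto
  moreover have "(0::nat) < 4" "(1::nat) < 4" "(2::nat) < 4" "(3::nat) < 4" by simp_all
  ultimately show ?thesis by blast
qed

text \<open>Distinct elements of \<open>T\<close> are incongruent modulo \<open>2R\<close>, so
  \<open>w - 1\<close> is a unit and cancels from the geometric sum formula.\<close>

lemma sum_powers_T:
  assumes "w \<in> T" "w \<noteq> 1" "w ^ (2 ^ n - 1) = 1"
  shows "(\<Sum>j<2 ^ n - 1. w ^ j) = 0"
proof -
  have "2 * (w - 1) \<noteq> 0" using assms T_cong_imp_eq[of w 1] by (auto simp: algebra_simps)
  then have "w - 1 dvd 1" by (rule is_unit_if_two_mult_neq_0)
  then obtain u where u: "1 = (w - 1) * u" by (rule dvdE)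
  have "(w - 1) * (\<Sum>j<2 ^ n - 1. w ^ j) = 0"
    using power_diff_1_eq[of w "2 ^ n - 1"] assms(3) by simp
  then have "((w - 1) * u) * (\<Sum>j<2 ^ n - 1. w ^ j) = 0"
    by (simp only: mult.assoc mult.left_commute[of _ u] mult_zero_right)
  then show ?thesis by (simp only: u[symmetric] mult_1)
qed

text \<open>Doubling kills the component in \<open>2R\<close>, so the trace polynomial of the
  residue field may be evaluated at any \<open>x\<close>, not only at elements of
  \<open>T\<close>.\<close>

lemma two_mult_gtrace: "2 * gtrace n \<xi> x = (\<Sum>i<n. 2 * x ^ (2 ^ i))"
proof -
  obtain a b where x: "a \<in> T" "b \<in> T" "x = a + 2 * b" using decomposition .
  have "2 * x = 2 * a" by (simp add: x distrib_left)
  then have "2 * x ^ (2 ^ i) = 2 * a ^ (2 ^ i)" for i by (rule two_mult_power_cong)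
  then have "2 * x ^ (2 ^ i) = 2 * (frobenius n \<xi> ^^ i) x" for i
    unfolding x(3) frobenius_iter[OF x(1,2)] by (simp add: distrib_left)
  then show ?thesis by (simp add: gtrace_def sum_distrib_left)
qed

text \<open>If the trace vanished modulo 2, then so would the sum of \<open>Tr x / x\<close> over the nonzero
  \<open>x \<in> T\<close>; but in that sum all monomials except \<open>x / x\<close> cancel.\<close>
lemma gtrace_nontrivial: "\<exists>x. 2 * gtrace n \<xi> x \<noteq> 0"
proof (rule ccontr)
  let ?N = "2 ^ n - 1 :: nat"
  assume "\<nexists>x. 2 * gtrace n \<xi> x \<noteq> 0"
  then have zero: "(\<Sum>i<n. 2 * x ^ (2 ^ i)) = 0" for x :: 'a
    by (simp flip: two_mult_gtrace)
  \<comment> \<open>Since \<open>\<xi> ^ ?N = 1\<close>, the exponent \<open>?N - 1\<close> stands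
    for -1, so that \<open>w i ^ j\<close> is \<open>(\<xi> ^ j) ^ (2 ^ i)\<close> divided by
    \<open>\<xi> ^ j\<close>.\<close>
  define w where "w i = \<xi> ^ (2 ^ i + (?N - 1))" for i :: nat
  have w_power: "w i ^ j = (\<xi> ^ j) ^ (2 ^ i) * \<xi> ^ (j * (?N - 1))" for i j
    by (simp only: w_def mult.commute[of j] distrib_right flip: power_mult power_add)
  note N = N_pos
  have w_eq: "w i = \<xi> ^ (2 ^ i - 1)" for i
  proof -
    have "2 ^ i + (?N - 1) = (2 ^ i - 1) + ?N" using N by simp
    then show ?thesis by (simp only: w_def power_add generator_power mult_1_right)
  qed
  have cancel: "(\<Sum>j<?N. w i ^ j) = 0" if "i \<noteq> 0" "i < n" for i
  proof (rule sum_powers_T)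
    show "w i \<in> T" by (simp add: w_def T_eq)
    show "w i ^ ?N = 1" by (metis w_def generator_power mult.commute power_mult power_one)
    have "(2::nat) ^ i < 2 ^ n" using that by simp
    then have "2 ^ i - 1 < ?N" by (intro diff_less_mono) auto
    moreover have "2 ^ i - 1 \<noteq> (0::nat)" using that one_less_power[of "2::nat" i] by simp
    ultimately have "\<xi> ^ (2 ^ i - 1) \<noteq> \<xi> ^ 0"
      using inj_onD[OF inj_on_powers, of "2 ^ i - 1" 0] N by auto
    then show "w i \<noteq> 1" by (simp add: w_eq)
  qed
  have "0 = (\<Sum>j<?N. (\<Sum>i<n. 2 * (\<xi> ^ j) ^ (2 ^ i)) * \<xi> ^ (j * (?N - 1)))"
    by (simp add: zero)
  also have "\<dots> = (\<Sum>j<?N. \<Sum>i<n. 2 * w i ^ j)"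
    by (simp only: w_power sum_distrib_right mult.assoc)
  also have "\<dots> = (\<Sum>i<n. 2 * (\<Sum>j<?N. w i ^ j))"
    by (simp add: sum.swap[of _ "{..<n}"] sum_distrib_left)
  \<comment> \<open>As \<open>w 0 = 1\<close>, the linear monomial contributes the number of
    summands.\<close>
  also have "\<dots> = (\<Sum>i<n. if i = 0 then 2 * of_nat ?N else 0)"
    using cancel by (intro sum.cong) (simp_all add: w_eq[of 0])
  also have "\<dots> = 2 * of_nat ?N" using n_pos by simp
  also have "of_nat ?N = (2 ^ n - 1 :: 'a)" by (simp add: of_nat_diff)
  \<comment> \<open>For \<open>n > 0\<close> the product \<open>2 * 2 ^ n\<close> is a multiple of
    4.\<close>
  also have "2 * (2 ^ n - 1) = - (2 :: 'a)"
    using n_pos by (cases n) (simp_all add: right_diff_distrib)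
  finally show False using two_neq_0 by simp
qed

section \<open>Additive characters and their orthogonality\<close>

lemma add_char_eq:
  assumes "gtrace n \<xi> (a * x) = of_nat k"
  shows "add_char n \<xi> a x = \<i> ^ k"
proof -
  have cong: "(of_nat j = (of_nat k :: 'a)) = (j mod 4 = k mod 4)" for j
    by (simp add: of_nat_eq_iff_cong_CHAR CHAR_eq cong_def)
  \<comment> \<open>Any natural number representing the trace agrees with the defining exponent
    modulo 4, which is both the characteristic and the order of \<open>\<i>\<close>.\<close>
  have "(THE j::nat. j < 4 \<and> of_nat j = gtrace n \<xi> (a * x)) = k mod 4"
    unfolding assms cong by (rule the_equality) auto
  moreover have "\<i> ^ (k mod 4) = \<i> ^ k"
  proof -
    have "\<i> ^ k = (\<i> ^ 4) ^ (k div 4) * \<i> ^ (k mod 4)"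
      by (simp only: mult_div_mod_eq flip: power_mult power_add)
    moreover have "\<i> ^ 4 = 1" by (simp add: numeral_eq_Suc)
    ultimately show ?thesis by simp
  qed
  ultimately show ?thesis by (simp add: add_char_def)
qed

text \<open>One character suffices: the one with index \<open>a\<close> maps \<open>x\<close> to
  \<open>chi (a * x)\<close>.\<close>

definition chi :: "'a \<Rightarrow> complex" where "chi = add_char n \<xi> 1"

lemma add_char_chi: "add_char n \<xi> a x = chi (a * x)"
  by (simp add: add_char_def chi_def)

lemma chi_eq: "gtrace n \<xi> x = of_nat k \<Longrightarrow> chi x = \<i> ^ k"
  by (simp add: chi_def add_char_eq)

lemma chi_add: "chi (x + y) = chi x * chi y"
proof -
  obtain j k where jk: "gtrace n \<xi> x = of_nat j" "gtrace n \<xi> y = of_nat k"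
    using gtrace_of_nat by blast
  then have "gtrace n \<xi> (x + y) = of_nat (j + k)" by (simp add: gtrace_add)
  from chi_eq[OF this] show ?thesis using chi_eq[OF jk(1)] chi_eq[OF jk(2)] by (simp add: power_add)
qed

lemma gtrace_0: "gtrace n \<xi> 0 = 0"
  using gtrace_add[of 0 0] by simp

lemma chi_0 [simp]: "chi 0 = 1"
  using chi_eq[of 0 0] by (simp add: gtrace_0)

lemma norm_chi: "norm (chi x) = 1"
proof -
  obtain k where "gtrace n \<xi> x = of_nat k" using gtrace_of_nat by blast
  then have "chi x = \<i> ^ k" by (rule chi_eq)
  then show ?thesis by (simp add: norm_power)
qed

lemma cnj_chi: "cnj (chi x) = chi (- x)"
proof -
  have "chi x * cnj (chi x) = 1" using complex_norm_square[of "chi x"] by (simp add: norm_chi)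
  moreover have "chi x * chi (- x) = 1" by (simp flip: chi_add)
  ultimately show ?thesis by (metis mult_cancel_left mult_zero_left zero_neq_one)
qed

lemma chi_gaussian: "\<exists>(u::int) (v::int). chi x = Complex u v"
proof -
  have "\<exists>(u::int) (v::int). \<i> ^ k = Complex u v" for k
  proof (induction k)
    case 0
    show ?case by (rule exI[of _ 1], rule exI[of _ 0]) (simp add: complex_eq_iff)
  next
    case (Suc k)
    then obtain u v :: int where "\<i> ^ k = Complex u v" by blast
    then show ?case by (intro exI[of _ "- v"] exI[of _ u]) (simp add: complex_eq_iff)
  qed
  moreover obtain k where "gtrace n \<xi> x = of_nat k" using gtrace_of_nat by blast
  then have "chi x = \<i> ^ k" by (rule chi_eq)
  ultimately show ?thesis by simp
qed

lemma gtrace_two_mult: "gtrace n \<xi> (2 * x) = 2 * gtrace n \<xi> x"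
  unfolding mult_2 by (rule gtrace_add)

text \<open>Nondegeneracy of the trace form. If \<open>a\<close> is a unit, \<open>a * x\<close> can
  be made equal to \<open>y\<close>. If \<open>a = 2 * u\<close> is nonzero, then \<open>u\<close>
  is a unit and \<open>a * x\<close> can be made \<open>2 * y\<close>; for this case the trace has
  to be nontrivial even after doubling.\<close>

lemma chi_nontrivial:
  assumes "a \<noteq> 0"
  shows "\<exists>x. chi (a * x) \<noteq> 1"
proof -
  obtain y where y: "2 * gtrace n \<xi> y \<noteq> 0" using gtrace_nontrivial by blast
  have solve: "\<exists>x. u * x = y" if unit: "2 * u \<noteq> 0" for u
  proof -
    obtain v where "1 = u * v" using is_unit_if_two_mult_neq_0[OF unit] by (rule dvdE)
    then have "u * (v * y) = y" by (simp flip: mult.assoc)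
    then show ?thesis by blast
  qed
  have "\<exists>x. gtrace n \<xi> (a * x) \<noteq> 0"
  proof (cases "2 * a = 0")
    case True
    then obtain u where u: "a = 2 * u" by (auto simp: two_mult_eq_0_iff dvd_def)
    then have "2 * u \<noteq> 0" using assms by simp
    from solve[OF this] obtain x where "u * x = y" by blast
    then have "a * x = 2 * y" by (simp add: u mult.assoc)
    then show ?thesis using y by (metis gtrace_two_mult)
  next
    case False
    from solve[OF this] obtain x where "a * x = y" by blast
    then show ?thesis using y by (metis mult_zero_right)
  qed
  then obtain x where x: "gtrace n \<xi> (a * x) \<noteq> 0" by blast
  obtain k where k: "k < 4" "gtrace n \<xi> (a * x) = of_nat k" using gtrace_of_nat by blast
  have "k \<noteq> 0" using x k by (intro notI) simp
  then consider "k = 1" | "k = 2" | "k = 3" using k(1) by linarith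
  then have "\<i> ^ k \<noteq> 1" by cases (simp_all add: complex_eq_iff power3_eq_cube)
  then show ?thesis using chi_eq[OF k(2)] by metis
qed

text \<open>For \<open>a \<noteq> 0\<close>, translating \<open>x\<close> by a suitable
  \<open>y\<close> multiplies the sum by \<open>chi (a * y) \<noteq> 1\<close>.\<close>

lemma sum_chi: "(\<Sum>x\<in>UNIV. chi (a * x)) = (if a = 0 then 4 ^ n else 0)"
proof (cases "a = 0")
  case True
  then show ?thesis by (simp add: card_eq)
next
  case False
  obtain y where y: "chi (a * y) \<noteq> 1" using chi_nontrivial[OF False] by blast
  have "(\<Sum>x\<in>UNIV. chi (a * x)) = (\<Sum>x\<in>UNIV. chi (a * (x + y)))"
    by (rule sum.reindex_bij_witness[where i = "\<lambda>x. x + y" and j = "\<lambda>x. x - y"]) auto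
  also have "\<dots> = (\<Sum>x\<in>UNIV. chi (a * x)) * chi (a * y)"
    by (simp add: distrib_left chi_add sum_distrib_right)
  finally show ?thesis using y False by simp
qed

lemma sum_UNIV_decomposition: "(\<Sum>x\<in>UNIV. g x) = (\<Sum>a\<in>T. \<Sum>b\<in>T. g (a + 2 * b))"
proof -
  have inj: "inj_on (\<lambda>(a, b). a + 2 * b) (T \<times> T)"
    using decomposition_unique by (auto simp: inj_on_def)
  have "(\<lambda>(a, b). a + 2 * b) ` (T \<times> T) = UNIV"
  proof (rule UNIV_eq_I[symmetric])
    fix x
    obtain a b where "a \<in> T" "b \<in> T" "x = a + 2 * b" by (rule decomposition)
    then show "x \<in> (\<lambda>(a, b). a + 2 * b) ` (T \<times> T)" by force
  qed
  then have "(\<Sum>x\<in>UNIV. g x) = (\<Sum>(a, b)\<in>T \<times> T. g (a + 2 * b))"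
    using sum.reindex[OF inj, of g] by (simp add: case_prod_unfold)
  then show ?thesis by (simp add: sum.cartesian_product)
qed

text \<open>The summand ignores the component in \<open>2R\<close>, so the vanishing sum over the
  whole ring is \<open>2 ^ n\<close> times the sum over \<open>T\<close>.\<close>

lemma sum_chi_two_mult_T:
  assumes "2 * a \<noteq> 0"
  shows "(\<Sum>t\<in>T. chi (2 * a * t)) = 0"
proof -
  have eq: "2 * a * (s + 2 * t) = 2 * a * s" for s t
    using two_two_mult[of "a * t"] by (simp add: algebra_simps)
  have "0 = (\<Sum>x\<in>UNIV. chi (2 * a * x))" using assms by (simp add: sum_chi)
  also have "\<dots> = (\<Sum>s\<in>T. \<Sum>t\<in>T. chi (2 * a * s))"
    by (simp only: sum_UNIV_decomposition eq)
  also have "\<dots> = 2 ^ n * (\<Sum>s\<in>T. chi (2 * a * s))" by (simp add: card_T sum_distrib_left)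
  finally show ?thesis by simp
qed

lemma sum_chi_T:
  assumes "2 * a = 0" "a \<noteq> 0"
  shows "(\<Sum>t\<in>T. chi (a * t)) = 0"
proof -
  have eq: "a * (s + 2 * t) = a * s" for s t
    using assms(1) by (simp add: distrib_left mult.left_commute[of a 2])
      (simp flip: mult.assoc)
  have "0 = (\<Sum>x\<in>UNIV. chi (a * x))" using assms by (simp add: sum_chi)
  also have "\<dots> = (\<Sum>s\<in>T. \<Sum>t\<in>T. chi (a * s))"
    by (simp only: sum_UNIV_decomposition eq)
  also have "\<dots> = 2 ^ n * (\<Sum>s\<in>T. chi (a * s))" by (simp add: card_T sum_distrib_left)
  finally show ?thesis by simp
qed

text \<open>The spectrum is indexed by the set of characters; injectivity allows indexing by ring
  elements with the same multiplicities.\<close>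

lemma inj_add_char: "inj (add_char n \<xi>)"
proof (rule injI)
  fix a b assume eq: "add_char n \<xi> a = add_char n \<xi> b"
  have "chi ((a - b) * x) = 1" for x
  proof -
    have "chi (a * x) = chi (b * x)" using fun_cong[OF eq, of x] by (simp add: add_char_chi)
    moreover have "chi (a * x) = chi ((a - b) * x) * chi (b * x)"
      by (simp add: algebra_simps flip: chi_add)
    moreover have "chi (b * x) \<noteq> 0" using norm_chi[of "b * x"] by auto
    ultimately show ?thesis by simp
  qed
  then show "a = b" using chi_nontrivial[of "a - b"] by auto
qed

end

section \<open>Powers of 2 as sums of two squares\<close>

lemma even_if_4_dvd_sum_squares:
  fixes u v :: int
  assumes "4 dvd u\<^sup>2 + v\<^sup>2"
  shows "even u" "even v"
proof -
  have "w\<^sup>2 mod 4 = (if even w then 0 else 1)" for w :: int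
  proof (cases "even w")
    case False
    then obtain k where "w = 2 * k + 1" by (rule oddE)
    then have "w\<^sup>2 = 1 + 4 * (k\<^sup>2 + k)" by (simp add: power2_eq_square algebra_simps)
    then have "w\<^sup>2 mod 4 = 1" by (simp only: mod_mult_self2) simp
    then show ?thesis using False by simp
  qed (auto elim!: evenE simp: power_mult_distrib)
  moreover have "(u\<^sup>2 mod 4 + v\<^sup>2 mod 4) mod 4 = 0" using assms by (simp add: mod_add_eq)
  ultimately show "even u" "even v" by (auto split: if_splits)
qed

text \<open>Descent: while 4 divides the sum, both numbers are even and can be halved, down to
  \<open>u\<^sup>2 + v\<^sup>2 = 1\<close>.\<close>

lemma sum_squares_eq_even_power_2:
  fixes u v :: int
  assumes "u\<^sup>2 + v\<^sup>2 = 2 ^ (2 * k)"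
  shows "\<bar>u\<bar> = 2 ^ k \<and> v = 0 \<or> u = 0 \<and> \<bar>v\<bar> = 2 ^ k"
  using assms
proof (induction k arbitrary: u v)
  case 0
  then have "u\<^sup>2 + v\<^sup>2 = 1" by simp
  moreover have "u\<^sup>2 \<ge> 0" "v\<^sup>2 \<ge> 0" by simp_all
  ultimately have "u\<^sup>2 = 1 \<and> v\<^sup>2 = 0 \<or> u\<^sup>2 = 0 \<and> v\<^sup>2 = 1" by linarith
  then show ?case by (auto simp: power2_eq_1_iff)
next
  case (Suc k)
  have "4 dvd u\<^sup>2 + v\<^sup>2" unfolding Suc.prems by simp
  then obtain x y where xy: "u = 2 * x" "v = 2 * y"
    using even_if_4_dvd_sum_squares by (meson evenE)
  then have "x\<^sup>2 + y\<^sup>2 = 2 ^ (2 * k)" using Suc.prems by (simp add: power_mult_distrib)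
  from Suc.IH[OF this] show ?case by (auto simp: xy abs_mult)
qed

text \<open>The same descent, ending at \<open>u\<^sup>2 + v\<^sup>2 = 2\<close>.\<close>

lemma sum_squares_eq_odd_power_2:
  fixes u v :: int
  assumes "u\<^sup>2 + v\<^sup>2 = 2 ^ (2 * k + 1)"
  shows "\<bar>u\<bar> = 2 ^ k \<and> \<bar>v\<bar> = 2 ^ k"
  using assms
proof (induction k arbitrary: u v)
  case 0
  then have eq: "u\<^sup>2 + v\<^sup>2 = 2" by simp
  have "\<bar>w\<bar> \<le> 1" if "w\<^sup>2 \<le> 2" for w :: int
  proof (rule ccontr)
    assume "\<not> \<bar>w\<bar> \<le> 1"
    then have "2\<^sup>2 \<le> \<bar>w\<bar>\<^sup>2" by (intro power_mono) auto
    then show False using that by simp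
  qed
  moreover have "u\<^sup>2 \<le> 2" "v\<^sup>2 \<le> 2"
    using eq zero_le_power2[of u] zero_le_power2[of v] by linarith+
  ultimately have "\<bar>u\<bar> \<le> 1" "\<bar>v\<bar> \<le> 1" by blast+
  then have "u \<in> {-1, 0, 1}" "v \<in> {-1, 0, 1}" by auto
  then show ?case using eq by auto
next
  case (Suc k)
  have "4 dvd u\<^sup>2 + v\<^sup>2" unfolding Suc.prems by simp
  then obtain x y where xy: "u = 2 * x" "v = 2 * y"
    using even_if_4_dvd_sum_squares by (meson evenE)
  then have "x\<^sup>2 + y\<^sup>2 = 2 ^ (2 * k + 1)" using Suc.prems by (simp add: power_mult_distrib)
  from Suc.IH[OF this] show ?case by (auto simp: xy abs_mult)
qed

section \<open>The set \<open>D_f\<close> and the values of its character sums\<close>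

locale pseudo_planar_function = galois_ring_char_4 +
  fixes f :: "'a \<Rightarrow> 'a"
  assumes planar: "pseudo_planar n \<xi> f" and f_0: "f 0 = 0"
begin

text \<open>The element of \<open>D_f\<close> in the residue class of \<open>x\<close>.\<close>

definition d :: "'a \<Rightarrow> 'a" where "d x = x + 2 * gsqrt n (f x)"

definition char_sum :: "'a \<Rightarrow> complex" where "char_sum a = (\<Sum>x\<in>T. chi (a * d x))"

lemma f_T: "x \<in> T \<Longrightarrow> f x \<in> T"
  using planar by (auto simp: pseudo_planar_def Let_def)

text \<open>The normalisation \<open>f 0 = 0\<close> enters here: it makes 0 a solution, and the
  first moment of the character sums counts the solutions.\<close>

lemma d_eq_0_iff: "x \<in> T \<Longrightarrow> d x = 0 \<longleftrightarrow> x = 0"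
proof
  assume "x \<in> T" "d x = 0"
  then show "x = 0"
    using decomposition_unique[of x "gsqrt n (f x)" 0 0] by (simp add: d_def gsqrt_T f_T)
next
  assume "x = 0"
  then show "d x = 0" by (simp add: d_def f_0 gsqrt_def zero_power)
qed

lemma inj_on_d: "inj_on d T"
  by (rule inj_onI, unfold d_def, drule decomposition_unique[rotated -1])
    (simp_all add: gsqrt_T f_T)

text \<open>Signs do not matter modulo \<open>2R\<close>, so \<open>x\<close> and \<open>y\<close>
  are congruent, hence equal; the sum is then \<open>2 * y\<close>.\<close>

lemma d_add_eq_0_iff:
  assumes "x \<in> T" "y \<in> T"
  shows "d x + d y = 0 \<longleftrightarrow> x = 0 \<and> y = 0"
proof
  assume eq: "d x + d y = 0"
  have "2 * x + 2 * y = 2 * (d x + d y)" by (simp add: d_def distrib_left)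
  then have "2 * x = 2 * (- y)" by (simp add: eq eq_neg_iff_add_eq_0)
  then have "x = y" using T_cong_imp_eq assms by (simp only: two_mult_uminus)
  moreover have "d y + d y = 2 * y" by (simp add: d_def distrib_left flip: mult_2)
  ultimately have "2 * y = 2 * 0" using eq by simp
  then have "y = 0" using T_cong_imp_eq assms zero_in_T by blast
  with \<open>x = y\<close> show "x = 0 \<and> y = 0" by simp
qed (use d_eq_0_iff[of 0] in auto)

text \<open>The bridge to pseudo-planarity: the carry \<open>2 * gsqrt n (y * \<epsilon>)\<close>
  from the addition of \<open>T\<close> supplies the summand \<open>\<epsilon> * y\<close> of the
  pseudo-planar map, and the minus sign before \<open>f y\<close> disappears under the factor
  2.\<close>

lemma d_difference:
  assumes "y \<in> T" "\<epsilon> \<in> T"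
  shows "d (teich (y + \<epsilon>)) - d y
    = \<epsilon> + 2 * gsqrt n (tadd n (tadd n (f (tadd n y \<epsilon>)) (f y)) (\<epsilon> * y))"
proof -
  let ?u = "f (teich (y + \<epsilon>))"
  have "tadd n (tadd n (f (tadd n y \<epsilon>)) (f y)) (\<epsilon> * y) = teich (teich (?u + f y) + \<epsilon> * y)"
    using assms by (simp add: tadd_eq f_T T_mult)
  also have "\<dots> = teich (?u + f y + \<epsilon> * y)" by (rule teich_cong) (simp add: distrib_left)
  finally have "2 * gsqrt n (tadd n (tadd n (f (tadd n y \<epsilon>)) (f y)) (\<epsilon> * y))
      = 2 * gsqrt n ?u + 2 * gsqrt n (f y) + 2 * gsqrt n (\<epsilon> * y)"
    by (simp only: two_mult_gsqrt_teich two_mult_gsqrt_add)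
  moreover have "d (teich (y + \<epsilon>)) - d y
      = \<epsilon> + (2 * gsqrt n ?u + 2 * (- gsqrt n (f y)) + 2 * gsqrt n (\<epsilon> * y))"
    using assms by (simp add: d_def teich_add teich_eq mult.commute)
  ultimately show ?thesis by (simp only: two_mult_uminus)
qed

lemma bij_teich_add:
  assumes "y \<in> T"
  shows "bij_betw (\<lambda>\<epsilon>. teich (y + \<epsilon>)) T T"
proof (rule bij_betw_byWitness[where f' = "\<lambda>x. teich (x - y)"])
  show "\<forall>\<epsilon>\<in>T. teich (teich (y + \<epsilon>) - y) = \<epsilon>"
    using teich_cong[of "teich (y + _) - y"] by (auto simp: right_diff_distrib distrib_left teich_eq)
  show "\<forall>x\<in>T. teich (y + teich (x - y)) = x"
    using teich_cong[of "y + teich (_ - y)"] by (auto simp: right_diff_distrib distrib_left teich_eq)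
qed auto

lemma char_sum_norm:
  assumes "2 * a \<noteq> 0"
  shows "char_sum a * cnj (char_sum a) = 2 ^ n"
proof -
  let ?P = "\<lambda>\<epsilon> y. tadd n (tadd n (f (tadd n y \<epsilon>)) (f y)) (\<epsilon> * y)"
  have inner: "(\<Sum>y\<in>T. chi (a * (d (teich (y + \<epsilon>)) - d y))) = (if \<epsilon> = 0 then 2 ^ n else 0)"
    if \<epsilon>: "\<epsilon> \<in> T" for \<epsilon>
  proof (cases "\<epsilon> = 0")
    case True
    then show ?thesis by (simp add: teich_eq card_T)
  next
    case False
    \<comment> \<open>Both the pseudo-planar map and the square root permute \<open>T\<close>, so
      their composite can be replaced by a free variable \<open>t\<close>.\<close>
    have "bij_betw (?P \<epsilon>) T T"
      using planar \<epsilon> False by (auto simp: pseudo_planar_def Let_def)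
    from bij_betw_trans[OF this bij_gsqrt]
    have bij: "bij_betw (\<lambda>y. gsqrt n (?P \<epsilon> y)) T T" by (simp add: comp_def)
    have "(\<Sum>y\<in>T. chi (a * (d (teich (y + \<epsilon>)) - d y)))
        = (\<Sum>y\<in>T. chi (a * \<epsilon>) * chi (2 * a * gsqrt n (?P \<epsilon> y)))"
      using \<epsilon> by (intro sum.cong refl) (simp only: d_difference distrib_left chi_add ac_simps)
    also have "\<dots> = chi (a * \<epsilon>) * (\<Sum>t\<in>T. chi (2 * a * t))"
      using sum.reindex_bij_betw[OF bij, of "\<lambda>t. chi (2 * a * t)"]
      by (simp only: sum_distrib_left[symmetric])
    finally show ?thesis using False by (simp add: sum_chi_two_mult_T[OF assms])
  qed
  have "char_sum a * cnj (char_sum a) = (\<Sum>x\<in>T. chi (a * d x)) * (\<Sum>y\<in>T. chi (- (a * d y)))"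
    by (simp add: char_sum_def cnj_chi)
  also have "\<dots> = (\<Sum>y\<in>T. \<Sum>x\<in>T. chi (a * (d x - d y)))"
    by (subst sum.swap) (simp add: sum_product right_diff_distrib flip: chi_add)
  \<comment> \<open>For fixed \<open>y\<close>, substitute for \<open>x\<close> the field sum of
    \<open>y\<close> and \<open>\<epsilon>\<close>.\<close>
  also have "\<dots> = (\<Sum>y\<in>T. \<Sum>\<epsilon>\<in>T. chi (a * (d (teich (y + \<epsilon>)) - d y)))"
    by (intro sum.cong refl sum.reindex_bij_betw[OF bij_teich_add, symmetric])
  also have "\<dots> = (\<Sum>\<epsilon>\<in>T. if \<epsilon> = 0 then 2 ^ n else 0)"
    by (subst sum.swap) (simp add: inner)
  finally show ?thesis by simp
qed

lemma char_sum_0: "char_sum 0 = 2 ^ n"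
  by (simp add: char_sum_def card_T)

lemma char_sum_annihilator: "2 * a = 0 \<Longrightarrow> a \<noteq> 0 \<Longrightarrow> char_sum a = 0"
proof -
  assume a: "2 * a = 0" "a \<noteq> 0"
  have "a * d x = a * x" for x
    using a(1) by (simp add: d_def distrib_left mult.left_commute[of a 2])
      (simp flip: mult.assoc)
  then show ?thesis using sum_chi_T[OF a] by (simp add: char_sum_def)
qed

lemma char_sum_eq_0_iff: "char_sum a = 0 \<longleftrightarrow> 2 * a = 0 \<and> a \<noteq> 0"
  using char_sum_norm[of a] char_sum_annihilator[of a] char_sum_0 by fastforce

text \<open>For \<open>2 * a \<noteq> 0\<close> the squared modulus is \<open>2 ^ n\<close>; the
  value \<open>2 ^ n\<close> would make it \<open>4 ^ n\<close>.\<close>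

lemma char_sum_eq_card_iff: "char_sum a = 2 ^ n \<longleftrightarrow> a = 0"
proof
  assume eq: "char_sum a = 2 ^ n"
  have "2 * a = 0"
  proof (rule ccontr)
    assume "2 * a \<noteq> 0"
    from char_sum_norm[OF this] have "(2::complex) ^ n * 2 ^ n = 2 ^ n" by (simp add: eq)
    then have "(2::complex) ^ n = 1" by simp
    then have "(2::real) ^ n = 1"
      by (metis norm_numeral norm_one norm_power)
    then show False using one_less_power[of "2::real" n] n_pos by simp
  qed
  then show "a = 0" using eq char_sum_eq_0_iff[of a] by auto
qed (simp add: char_sum_0)

lemma card_char_sum_eq_0: "card {a. char_sum a = 0} = 2 ^ n - 1"
proof -
  have "{a. char_sum a = 0} = range ((*) 2) - {0}"
    by (auto simp: char_sum_eq_0_iff two_mult_eq_0_iff)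
  moreover have "0 \<in> range ((*) (2::'a))" by (rule range_eqI[where x = 0]) simp
  ultimately show ?thesis by (simp add: card_two_multiples card_Diff_singleton)
qed

lemma char_sum_gaussian: "\<exists>(u::int) (v::int). char_sum a = Complex u v"
proof -
  have "\<exists>(u::int) (v::int). (\<Sum>x\<in>A. chi (g x)) = Complex u v" for A and g :: "'a \<Rightarrow> 'a"
  proof (induction A rule: infinite_finite_induct)
    case (insert x A)
    obtain u v :: int where "chi (g x) = Complex u v" using chi_gaussian by blast
    moreover obtain u' v' :: int where "(\<Sum>x\<in>A. chi (g x)) = Complex u' v'" using insert by blast
    ultimately have "(\<Sum>x\<in>insert x A. chi (g x)) = Complex (of_int (u + u')) (of_int (v + v'))"
      using insert by (simp add: complex_eq_iff)
    then show ?case by blast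
  qed (auto intro!: exI[of _ 0] simp: complex_eq_iff)
  then show ?thesis by (simp add: char_sum_def)
qed

lemma char_sum_sum_squares:
  assumes "2 * a \<noteq> 0"
  obtains u v :: int where "char_sum a = Complex u v" "u\<^sup>2 + v\<^sup>2 = 2 ^ n"
proof -
  obtain u v :: int where uv: "char_sum a = Complex u v" using char_sum_gaussian by blast
  have "Re (char_sum a * cnj (char_sum a)) = Re (of_real (2 ^ n))" by (simp add: char_sum_norm[OF assms])
  then have "(of_int (u\<^sup>2 + v\<^sup>2) :: real) = of_int (2 ^ n)"
    unfolding Re_complex_of_real by (simp add: uv power2_eq_square)
  then show ?thesis using that[OF uv] by (simp only: of_int_eq_iff)
qed

lemma char_sum_cases_odd:
  assumes "odd n" "2 * a \<noteq> 0" and c: "c = complex_of_real (2 ^ ((n - 1) div 2))"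
  shows "char_sum a \<in> {c + c * \<i>, c - c * \<i>, - c + c * \<i>, - c - c * \<i>}"
proof -
  define k where "k = (n - 1) div 2"
  have n: "n = 2 * k + 1" using assms(1) by (auto simp: k_def elim: oddE)
  obtain u v :: int where uv: "char_sum a = Complex u v" "u\<^sup>2 + v\<^sup>2 = 2 ^ n"
    by (rule char_sum_sum_squares[OF assms(2)])
  have "\<bar>u\<bar> = 2 ^ k \<and> \<bar>v\<bar> = 2 ^ k"
    by (rule sum_squares_eq_odd_power_2) (use uv(2) n in simp)
  then have "(u = 2 ^ k \<or> u = - (2 ^ k)) \<and> (v = 2 ^ k \<or> v = - (2 ^ k))" by linarith
  then show ?thesis unfolding c k_def[symmetric] uv(1) by (auto simp: complex_eq_iff)
qed

lemma char_sum_cases_even: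
  assumes "even n" "2 * a \<noteq> 0" and c: "c = complex_of_real (2 ^ ((n - 2) div 2))"
  shows "char_sum a \<in> {2 * c, - 2 * c, 2 * c * \<i>, - 2 * c * \<i>}"
proof -
  define k where "k = (n - 2) div 2"
  \<comment> \<open>Even and positive, \<open>n\<close> is at least 2, so \<open>n - 2\<close> is
    not truncated. The modulus is therefore \<open>2 ^ Suc k\<close>, whence the factor 2 in the
    values.\<close>
  have n: "n = 2 * Suc k" using assms(1) n_pos by (auto simp: k_def elim: evenE)
  obtain u v :: int where uv: "char_sum a = Complex u v" "u\<^sup>2 + v\<^sup>2 = 2 ^ n"
    by (rule char_sum_sum_squares[OF assms(2)])
  have "\<bar>u\<bar> = 2 ^ Suc k \<and> v = 0 \<or> u = 0 \<and> \<bar>v\<bar> = 2 ^ Suc k"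
    by (rule sum_squares_eq_even_power_2) (use uv(2) n in simp)
  then have "(u = 2 * 2 ^ k \<or> u = - (2 * 2 ^ k)) \<and> v = 0 \<or> u = 0 \<and> (v = 2 * 2 ^ k \<or> v = - (2 * 2 ^ k))"
    unfolding power_Suc by linarith
  then show ?thesis unfolding c k_def[symmetric] uv(1) by (auto simp: complex_eq_iff)
qed

section \<open>Moments of the character sums and the passage to the spectrum\<close>

lemma sum_char_sum: "(\<Sum>a\<in>UNIV. char_sum a) = 4 ^ n"
proof -
  have "(\<Sum>a\<in>UNIV. char_sum a) = (\<Sum>x\<in>T. \<Sum>a\<in>UNIV. chi (d x * a))"
    unfolding char_sum_def by (subst sum.swap) (simp add: mult.commute)
  also have "\<dots> = (\<Sum>x\<in>T. if x = 0 then 4 ^ n else 0)"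
    by (intro sum.cong refl) (simp add: sum_chi d_eq_0_iff)
  finally show ?thesis by simp
qed

text \<open>The plain square is taken because the squared modulus is the same for all
  \<open>a\<close> with \<open>2 * a \<noteq> 0\<close>, while the square still depends on the
  argument of the value.\<close>

lemma sum_char_sum_square: "(\<Sum>a\<in>UNIV. (char_sum a)\<^sup>2) = 4 ^ n"
proof -
  have "(\<Sum>a\<in>UNIV. (char_sum a)\<^sup>2) = (\<Sum>a\<in>UNIV. \<Sum>x\<in>T. \<Sum>y\<in>T. chi ((d x + d y) * a))"
    by (simp add: char_sum_def power2_eq_square sum_product distrib_left chi_add mult.commute)
  also have "\<dots> = (\<Sum>x\<in>T. \<Sum>y\<in>T. \<Sum>a\<in>UNIV. chi ((d x + d y) * a))"
    by (subst sum.swap, rule sum.cong[OF refl], rule sum.swap)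
  also have "\<dots> = (\<Sum>x\<in>T. \<Sum>y\<in>T. if y = 0 then if x = 0 then 4 ^ n else 0 else 0)"
    by (intro sum.cong refl) (simp add: sum_chi d_add_eq_0_iff)
  finally show ?thesis by simp
qed

lemma fourier_spectrum_eq:
  "fourier_spectrum n \<xi> (D_set n \<xi> f) = image_mset char_sum (mset_set UNIV)"
proof -
  have D: "D_set n \<xi> f = d ` T" by (auto simp: D_set_def d_def)
  have chars: "add_chars n \<xi> = range (add_char n \<xi>)" by (auto simp: add_chars_def)
  have "(\<Sum>g\<in>d ` T. add_char n \<xi> a g) = char_sum a" for a
    by (simp add: sum.reindex[OF inj_on_d] char_sum_def add_char_chi)
  then show ?thesis
    by (simp add: fourier_spectrum_def D chars image_mset.compositionality comp_def
        flip: image_mset_mset_set[OF inj_add_char])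
qed

lemma count_fourier_spectrum:
  "count (fourier_spectrum n \<xi> (D_set n \<xi> f)) v = card {a. char_sum a = v}"
  by (simp add: fourier_spectrum_eq count_image_mset vimage_def)

text \<open>Taking \<open>h\<close> to be 1, the identity and the square turns the total count and
  the two moments into linear equations for the frequencies.\<close>

lemma sum_char_sum_values:
  assumes "range char_sum \<subseteq> V" "finite V"
  shows "(\<Sum>a\<in>UNIV. h (char_sum a)) = (\<Sum>v\<in>V. of_nat (card {a. char_sum a = v}) * h v :: complex)"
proof -
  have "(\<Sum>a\<in>UNIV. h (char_sum a)) = (\<Sum>v\<in>V. \<Sum>a\<in>{a\<in>UNIV. char_sum a = v}. h (char_sum a))"
    by (rule sum.group[symmetric]) (use assms in auto)
  then show ?thesis by simp
qed

section \<open>The frequencies as the solution of a linear system\<close>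

abbreviation freq :: "complex \<Rightarrow> nat" where "freq v \<equiv> card {a. char_sum a = v}"

lemma freq_0: "real (freq 0) = 2 ^ n - 1"
  by (simp add: card_char_sum_eq_0 of_nat_diff)

lemma freq_card: "freq (2 ^ n) = 1"
  by (simp add: char_sum_eq_card_iff)

text \<open>The four unknown frequencies are determined by the number of characters, the real and
  imaginary parts of the first moment, and the imaginary part of the second, the squares of the four
  values being \<open>2 * c\<^sup>2 * \<i>\<close> up to sign.\<close>

lemma frequencies_odd:
  assumes "odd n" and b: "b = 2 ^ ((n - 1) div 2)" and c: "c = complex_of_real b"
  shows "range char_sum \<subseteq> {2 * c^2, 0, c + c * \<i>, c - c * \<i>, - c + c * \<i>, - c - c * \<i>}"
    and "freq (2 * c^2) = 1"
    and "real (freq 0) = 2 * b^2 - 1"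
    and "real (freq (c + c * \<i>)) = b * (2 * b^3 + 2 * b^2 - b - 1) / 2"
    and "real (freq (c - c * \<i>)) = b * (2 * b^3 + 2 * b^2 - b - 1) / 2"
    and "real (freq (- c + c * \<i>)) = b * (2 * b^3 - 2 * b^2 - b + 1) / 2"
    and "real (freq (- c - c * \<i>)) = b * (2 * b^3 - 2 * b^2 - b + 1) / 2"
proof -
  let ?V = "{2 * c^2, 0, c + c * \<i>, c - c * \<i>, - c + c * \<i>, - c - c * \<i>}"
  have b_pos: "b > 0" by (simp add: b)
  obtain k where n: "n = 2 * k + 1" using assms(1) by (rule oddE)
  have pow: "2 ^ n = 2 * b\<^sup>2" by (simp add: b n power_even_eq)
  then have pow_c: "2 ^ n = 2 * c\<^sup>2" by (metis c of_real_mult of_real_numeral of_real_power)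
  have "(4::real) ^ n = (2 ^ n)\<^sup>2" by (simp add: power2_eq_square flip: power_mult_distrib)
  then have pow4: "(4::real) ^ n = 4 * b ^ 4" by (simp add: pow power_mult_distrib flip: power_mult)
  show range: "range char_sum \<subseteq> ?V"
  proof
    fix z assume "z \<in> range char_sum"
    then obtain a where z: "z = char_sum a" by blast
    consider "a = 0" | "a \<noteq> 0" "2 * a = 0" | "2 * a \<noteq> 0" by blast
    then show "z \<in> ?V"
    proof cases
      case 1
      then show ?thesis by (simp add: z char_sum_0 pow_c)
    next
      case 2
      then show ?thesis by (simp add: z char_sum_annihilator)
    next
      case 3
      then show ?thesis using char_sum_cases_odd[OF assms(1) 3, of c] b c z by auto
    qed
  qed
  show full: "freq (2 * c^2) = 1" using freq_card by (simp add: pow_c)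
  show zero: "real (freq 0) = 2 * b^2 - 1" by (simp only: freq_0 pow)
  define p q r s where "p = real (freq (c + c * \<i>))" and "q = real (freq (c - c * \<i>))"
    and "r = real (freq (- c + c * \<i>))" and "s = real (freq (- c - c * \<i>))"
  have "finite ?V" by simp
  note sums = sum_char_sum_values[OF range this]
  \<comment> \<open>The values must be pairwise distinct for the sum over \<open>?V\<close> to split
    into six terms.\<close>
  have distinct: "2 * c^2 \<notin> {0, c + c * \<i>, c - c * \<i>, - c + c * \<i>, - c - c * \<i>}"
    "0 \<notin> {c + c * \<i>, c - c * \<i>, - c + c * \<i>, - c - c * \<i>}"
    "c + c * \<i> \<notin> {c - c * \<i>, - c + c * \<i>, - c - c * \<i>}"
    "c - c * \<i> \<notin> {- c + c * \<i>, - c - c * \<i>}"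
    "- c + c * \<i> \<notin> {- c - c * \<i>}"
    using b_pos by (auto simp: c complex_eq_iff simp flip: of_real_power)
  have sum_V: "(\<Sum>a\<in>UNIV. h (char_sum a)) = of_real 1 * h (2 * c^2) + of_real (2 * b^2 - 1) * h 0 +
      of_real p * h (c + c * \<i>) + of_real q * h (c - c * \<i>) +
      of_real r * h (- c + c * \<i>) + of_real s * h (- c - c * \<i>)" for h :: "complex \<Rightarrow> complex"
    unfolding sums[of h] p_def q_def r_def s_def zero[symmetric]
    using distinct full by (simp add: add.assoc)
  have "4 ^ n = Re (\<Sum>a\<in>(UNIV::'a set). 1)" by (simp add: card_eq)
  then have 1: "4 * b ^ 4 = 2 * b^2 + (p + q + r + s)"
    unfolding sum_V[of "\<lambda>_. 1"] pow4 by simp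
  have two: "Re (4 ^ n) = 4 * b ^ 4" "Im (4 ^ n) = 0"
    using pow4 by (metis Re_complex_of_real of_real_numeral of_real_power,
        metis Im_complex_of_real of_real_numeral of_real_power)
  have 2: "b * (p + q - r - s) = b * (4 * b ^ 3 - 2 * b)"
    using arg_cong[OF sum_char_sum, of Re] unfolding sum_V[of "\<lambda>z. z"] two
    by (simp add: c algebra_simps power2_eq_square eval_nat_numeral)
  have 3: "b * (p - q + r - s) = b * 0"
    using arg_cong[OF sum_char_sum, of Im] unfolding sum_V[of "\<lambda>z. z"] two
    by (simp add: c algebra_simps power2_eq_square)
  have 4: "b\<^sup>2 * (p - q - r + s) = b\<^sup>2 * 0"
    using arg_cong[OF sum_char_sum_square, of Im] unfolding sum_V[of "\<lambda>z. z\<^sup>2"] two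
    by (simp add: c algebra_simps power2_eq_square)
  \<comment> \<open>With the nonzero powers of \<open>b\<close> cancelled, the coefficients form a
    Hadamard matrix of order 4, so the solution is unique.\<close>
  note eqs = 1 mult_left_cancel[THEN iffD1, OF _ 2] mult_left_cancel[THEN iffD1, OF _ 3]
    mult_left_cancel[THEN iffD1, OF _ 4]
  have "b * (2 * b^3 + 2 * b^2 - b - 1) / 2 = (2 * b^4 + 2 * b^3 - b^2 - b) / 2"
    "b * (2 * b^3 - 2 * b^2 - b + 1) / 2 = (2 * b^4 - 2 * b^3 - b^2 + b) / 2"
    by (simp_all add: algebra_simps power2_eq_square eval_nat_numeral)
  then show "p = b * (2 * b^3 + 2 * b^2 - b - 1) / 2" "q = b * (2 * b^3 + 2 * b^2 - b - 1) / 2"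
    "r = b * (2 * b^3 - 2 * b^2 - b + 1) / 2" "s = b * (2 * b^3 - 2 * b^2 - b + 1) / 2"
    using eqs b_pos by simp_all
qed

text \<open>Here the squares of the four values are real, so the real part of the second moment
  takes over: it says that real and imaginary values occur equally often among them.\<close>

lemma frequencies_even:
  assumes "even n" and b: "b = 2 ^ ((n - 2) div 2)" and c: "c = complex_of_real b"
  shows "range char_sum \<subseteq> {4 * c^2, 0, 2 * c, - 2 * c, 2 * c * \<i>, - 2 * c * \<i>}"
    and "freq (4 * c^2) = 1"
    and "real (freq 0) = 4 * b^2 - 1"
    and "real (freq (2 * c)) = b * (4 * b^3 + 4 * b^2 - b - 1)"
    and "real (freq (- 2 * c)) = b * (4 * b^3 - 4 * b^2 - b + 1)"
    and "real (freq (2 * c * \<i>)) = b^2 * (4 * b^2 - 1)"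
    and "real (freq (- 2 * c * \<i>)) = b^2 * (4 * b^2 - 1)"
proof -
  let ?V = "{4 * c^2, 0, 2 * c, - 2 * c, 2 * c * \<i>, - 2 * c * \<i>}"
  define k where "k = (n - 2) div 2"
  have n: "n = 2 * Suc k" using assms(1) n_pos by (auto simp: k_def elim: evenE)
  have b_ge: "b \<ge> 1" by (simp add: b)
  have pow: "2 ^ n = 4 * b\<^sup>2"
    unfolding b k_def[symmetric] unfolding n power_even_eq by (simp add: power_mult_distrib)
  then have pow_c: "2 ^ n = 4 * c\<^sup>2" by (metis c of_real_mult of_real_numeral of_real_power)
  have "(4::real) ^ n = (2 ^ n)\<^sup>2" by (simp add: power2_eq_square flip: power_mult_distrib)
  then have pow4: "(4::real) ^ n = 16 * b ^ 4" by (simp add: pow power_mult_distrib flip: power_mult)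
  show range: "range char_sum \<subseteq> ?V"
  proof
    fix z assume "z \<in> range char_sum"
    then obtain a where z: "z = char_sum a" by blast
    consider "a = 0" | "a \<noteq> 0" "2 * a = 0" | "2 * a \<noteq> 0" by blast
    then show "z \<in> ?V"
    proof cases
      case 1
      then show ?thesis by (simp add: z char_sum_0 pow_c)
    next
      case 2
      then show ?thesis by (simp add: z char_sum_annihilator)
    next
      case 3
      then show ?thesis using char_sum_cases_even[OF assms(1) 3, of c] b c z by auto
    qed
  qed
  show full: "freq (4 * c^2) = 1" using freq_card by (simp add: pow_c)
  show zero: "real (freq 0) = 4 * b^2 - 1" by (simp only: freq_0 pow)
  define p q r s where "p = real (freq (2 * c))" and "q = real (freq (- 2 * c))"
    and "r = real (freq (2 * c * \<i>))" and "s = real (freq (- 2 * c * \<i>))"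
  have "finite ?V" by simp
  note sums = sum_char_sum_values[OF range this]
  \<comment> \<open>The trivial value is real and could only coincide with \<open>2 * c\<close> or
    \<open>- 2 * c\<close>; \<open>b \<ge> 1\<close> excludes both.\<close>
  have "4 * b\<^sup>2 \<noteq> 2 * b"
    using b_ge mult_left_mono[of 1 b b] by (simp add: power2_eq_square)
  moreover have "2 * b\<^sup>2 \<noteq> - b" using b_ge zero_le_power2[of b] by linarith
  ultimately have distinct: "4 * c^2 \<notin> {0, 2 * c, - 2 * c, 2 * c * \<i>, - 2 * c * \<i>}"
    "0 \<notin> {2 * c, - 2 * c, 2 * c * \<i>, - 2 * c * \<i>}"
    "2 * c \<notin> {- 2 * c, 2 * c * \<i>, - 2 * c * \<i>}"
    "- 2 * c \<notin> {2 * c * \<i>, - 2 * c * \<i>}"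
    "2 * c * \<i> \<notin> {- 2 * c * \<i>}"
    using b_ge by (auto simp: c complex_eq_iff simp flip: of_real_power)
  have sum_V: "(\<Sum>a\<in>UNIV. h (char_sum a)) = of_real 1 * h (4 * c^2) + of_real (4 * b^2 - 1) * h 0 +
      of_real p * h (2 * c) + of_real q * h (- 2 * c) +
      of_real r * h (2 * c * \<i>) + of_real s * h (- 2 * c * \<i>)" for h :: "complex \<Rightarrow> complex"
    unfolding sums[of h] p_def q_def r_def s_def zero[symmetric]
    using distinct full by (simp add: add.assoc)
  have "4 ^ n = Re (\<Sum>a\<in>(UNIV::'a set). 1)" by (simp add: card_eq)
  then have 1: "16 * b ^ 4 = 4 * b^2 + (p + q + r + s)"
    unfolding sum_V[of "\<lambda>_. 1"] pow4 by simp
  have two: "Re (4 ^ n) = 16 * b ^ 4" "Im (4 ^ n) = 0"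
    using pow4 by (metis Re_complex_of_real of_real_numeral of_real_power,
        metis Im_complex_of_real of_real_numeral of_real_power)
  have 2: "b * (p - q) = b * (8 * b ^ 3 - 2 * b)"
    using arg_cong[OF sum_char_sum, of Re] unfolding sum_V[of "\<lambda>z. z"] two
    by (simp add: c algebra_simps power2_eq_square eval_nat_numeral)
  have 3: "b * (r - s) = b * 0"
    using arg_cong[OF sum_char_sum, of Im] unfolding sum_V[of "\<lambda>z. z"] two
    by (simp add: c algebra_simps power2_eq_square)
  have 4: "b\<^sup>2 * (p + q - r - s) = b\<^sup>2 * 0"
    using arg_cong[OF sum_char_sum_square, of Re] unfolding sum_V[of "\<lambda>z. z\<^sup>2"] two
    by (simp add: c algebra_simps power2_eq_square eval_nat_numeral)
  note eqs = 1 mult_left_cancel[THEN iffD1, OF _ 2] mult_left_cancel[THEN iffD1, OF _ 3]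
    mult_left_cancel[THEN iffD1, OF _ 4]
  have "b * (4 * b^3 + 4 * b^2 - b - 1) = 4 * b^4 + 4 * b^3 - b^2 - b"
    "b * (4 * b^3 - 4 * b^2 - b + 1) = 4 * b^4 - 4 * b^3 - b^2 + b"
    "b^2 * (4 * b^2 - 1) = 4 * b^4 - b^2"
    by (simp_all add: algebra_simps power2_eq_square eval_nat_numeral)
  then show "p = b * (4 * b^3 + 4 * b^2 - b - 1)" "q = b * (4 * b^3 - 4 * b^2 - b + 1)"
    "r = b^2 * (4 * b^2 - 1)" "s = b^2 * (4 * b^2 - 1)"
    using eqs b_ge by simp_all
qed

end

theorem corollary4p6:
  fixes \<xi> :: "'a::{finite,comm_ring_1}" and f :: "'a \<Rightarrow> 'a" and n :: nat
  assumes "galois_ring_4 TYPE('a) n"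
    and "teichmuller_generator n \<xi>"
    and "pseudo_planar n \<xi> f"
    and "f 0 = 0"
  shows "let S = fourier_spectrum n \<xi> (D_set n \<xi> f) in
    (odd n \<longrightarrow>
      (let b = 2 ^ ((n - 1) div 2) :: real; c = complex_of_real b in
        set_mset S \<subseteq> {2 * c^2, 0, c + c * \<i>, c - c * \<i>, - c + c * \<i>, - c - c * \<i>} \<and>
        real (count S (2 * c^2)) = 1 \<and>
        real (count S 0) = 2 * b^2 - 1 \<and>
        real (count S (c + c * \<i>)) = b * (2 * b^3 + 2 * b^2 - b - 1) / 2 \<and>
        real (count S (c - c * \<i>)) = b * (2 * b^3 + 2 * b^2 - b - 1) / 2 \<and>
        real (count S (- c + c * \<i>)) = b * (2 * b^3 - 2 * b^2 - b + 1) / 2 \<and>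
        real (count S (- c - c * \<i>)) = b * (2 * b^3 - 2 * b^2 - b + 1) / 2)) \<and>
    (even n \<longrightarrow>
      (let b = 2 ^ ((n - 2) div 2) :: real; c = complex_of_real b in
        set_mset S \<subseteq> {4 * c^2, 0, 2 * c, - 2 * c, 2 * c * \<i>, - 2 * c * \<i>} \<and>
        real (count S (4 * c^2)) = 1 \<and>
        real (count S 0) = 4 * b^2 - 1 \<and>
        real (count S (2 * c)) = b * (4 * b^3 + 4 * b^2 - b - 1) \<and>
        real (count S (- 2 * c)) = b * (4 * b^3 - 4 * b^2 - b + 1) \<and>
        real (count S (2 * c * \<i>)) = b^2 * (4 * b^2 - 1) \<and>
        real (count S (- 2 * c * \<i>)) = b^2 * (4 * b^2 - 1)))"
proof -
  interpret pseudo_planar_function n \<xi> f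
    by unfold_locales (fact assms)+
  have set: "set_mset (fourier_spectrum n \<xi> (D_set n \<xi> f)) = range char_sum"
    by (simp add: fourier_spectrum_eq)
  show ?thesis
    unfolding Let_def count_fourier_spectrum set
    by (intro conjI impI frequencies_odd[OF _ refl refl] frequencies_even[OF _ refl refl]
        of_nat_eq_1_iff[THEN iffD2] refl)
qed

end
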